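(* Let $V$ be a finite-dimensional real Euclidean space, let $G=O(V)$ be its orthogonal group, and let $\Phi=\{v\in V : \|v\|=1\}$ be the unit sphere of $V$ with its natural action of $G\times\{\pm 1\}$ ($G$ acts by restriction of its linear action, and $-1$ acts by $v\mapsto -v$). Fix a vector-space total ordering $\preceq$ of $V$, and let $\Phi^{+}=\{v\in\Phi : 0\prec v\}$ and $\Phi^{-}=-\Phi^{+}$. Then $(G,\Phi)$, with the partition $\Phi=\Phi^+\cup\Phi^-$, is a complete, rootoidal, signed group-set.
   Context: A vector-space total ordering of $V$ is a total order $\preceq$ on $V$ such that $x\preceq y$ implies $x+z\preceq y+z$ for all $z\in V$ and $rx\preceq ry$ for all real $r\ge 0$; $x\prec y$ means $x\preceq y$ and $x\neq y$. A signed group-set is a pair $(G,\Phi)$ such that: (1) $G$ is a group; (2) $\Phi$ is a set with a given left action of the product group $G\times\{\pm1\}$ (so $G$ and $\{\pm1\}$ have commuting left actions on $\Phi$); (3) there is a specified partition $\Phi=\Phi^{+}\cup\Phi^{-}$ into two disjoint subsets which are interchanged by the action of $-1$. For $g\in G$ put $\Phi_g:=\Phi^{+}\cap g(\Phi^{-})$. The weak order of $(G,\Phi)$ is the set $\mathcal{L}:=\{\Phi_g : g\in G\}$ of subsets of $\Phi^{+}$, partially ordered by inclusion. A signed group-set $(G,\Phi)$ is rootoidal if in addition: (4) if $g\in G$ and $\Phi_g=\emptyset$, then $g=1_G$; (5) $\mathcal{L}$ is a complete meet semilattice, i.e. each non-empty subset of $\mathcal{L}$ has a meet (greatest lower bound)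 in $\mathcal{L}$; (6) given a non-empty family $(A_i)_{i\in I}$ of elements of $\mathcal{L}$ and $B\in\mathcal{L}$ such that $A_i\cap B=\emptyset$ for all $i\in I$, if the join (least upper bound) $A:=\bigvee_{i\in I}A_i$ exists in $\mathcal{L}$, then $A\cap B=\emptyset$. A rootoidal signed group-set is complete if $\mathcal{L}$ has a maximum element, or equivalently if $\mathcal{L}$ is a complete lattice (every subset has a join and a meet in $\mathcal{L}$). *)

theory Defs
  imports
    "HOL-Analysis.Analysis"
    "HOL-Algebra.Group_Action"
    "HOL-Algebra.Sym_Groups"
    "HOL-Algebra.Complete_Lattice"
begin

section \<open>Signed group-sets\<close>

text \<open>
  The group \<open>{\<plusminus>1}\<close> is the library's \<^const>\<open>sign_img\<close>, and a left action of a group on \<open>\<Phi>\<close> is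
  a \<^const>\<open>group_action\<close>, i.e. a homomorphism into the group of (extensional) bijections of \<open>\<Phi>\<close>.
\<close>

locale signed_group_set = group G for G (structure) +
  fixes \<Phi> :: "'b set" and act :: "'a \<times> int \<Rightarrow> 'b \<Rightarrow> 'b" and \<Phi>pos \<Phi>neg :: "'b set"
  assumes action: "group_action (G \<times>\<times> sign_img) \<Phi> act"
    and partition: "\<Phi> = \<Phi>pos \<union> \<Phi>neg" "\<Phi>pos \<inter> \<Phi>neg = {}"
    and interchange: "act (\<one>, -1) ` \<Phi>pos = \<Phi>neg" "act (\<one>, -1) ` \<Phi>neg = \<Phi>pos"
begin

definition inversion_set :: "'a \<Rightarrow> 'b set"
  where "inversion_set g = \<Phi>pos \<inter> act (g, 1) ` \<Phi>neg"

definition weak_order :: "'b set gorder"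
  where "weak_order = \<lparr>carrier = inversion_set ` carrier G, eq = (=), le = (\<subseteq>)\<rparr>"

lemma partial_order_weak_order: "partial_order weak_order"
  by unfold_locales (auto simp: weak_order_def)

end

locale rootoidal_signed_group_set = signed_group_set +
  assumes trivial_if_inversion_set_empty:
      "\<lbrakk>g \<in> carrier G; inversion_set g = {}\<rbrakk> \<Longrightarrow> g = \<one>"
    and meet_exists:
      "\<lbrakk>\<A> \<subseteq> carrier weak_order; \<A> \<noteq> {}\<rbrakk> \<Longrightarrow> \<exists>M. is_glb weak_order M \<A>"
    and join_disjoint:
      "\<lbrakk>\<A> \<subseteq> carrier weak_order; \<A> \<noteq> {}; B \<in> carrier weak_order;
        \<And>A. A \<in> \<A> \<Longrightarrow> A \<inter> B = {}; is_lub weak_order J \<A>\<rbrakk> \<Longrightarrow> J \<inter> B = {}"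

locale complete_rootoidal_signed_group_set = rootoidal_signed_group_set +
  assumes maximum_exists: "\<exists>M. greatest weak_order M (carrier weak_order)"

lemma complete_rootoidal_signed_group_set_iff:
  "complete_rootoidal_signed_group_set G \<Phi> act \<Phi>pos \<Phi>neg \<longleftrightarrow>
     rootoidal_signed_group_set G \<Phi> act \<Phi>pos \<Phi>neg \<and>
     complete_lattice (signed_group_set.weak_order G act \<Phi>pos \<Phi>neg)"
proof
  assume "complete_rootoidal_signed_group_set G \<Phi> act \<Phi>pos \<Phi>neg"
  then interpret complete_rootoidal_signed_group_set G \<Phi> act \<Phi>pos \<Phi>neg .
  show "rootoidal_signed_group_set G \<Phi> act \<Phi>pos \<Phi>neg \<and> complete_lattice weak_order"
    using partial_order.complete_lattice_criterion1[OF partial_order_weak_order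
        maximum_exists meet_exists] rootoidal_signed_group_set_axioms by blast
next
  assume *: "rootoidal_signed_group_set G \<Phi> act \<Phi>pos \<Phi>neg \<and>
    complete_lattice (signed_group_set.weak_order G act \<Phi>pos \<Phi>neg)"
  then interpret rootoidal_signed_group_set G \<Phi> act \<Phi>pos \<Phi>neg by blast
  interpret complete_lattice weak_order using * by blast
  obtain M where "is_lub weak_order M (carrier weak_order)"
    using sup_exists[OF subset_refl] by blast
  then have "greatest weak_order M (carrier weak_order)"
    unfolding least_def greatest_def Upper_def by auto
  then show "complete_rootoidal_signed_group_set G \<Phi> act \<Phi>pos \<Phi>neg"
    by unfold_locales blast
qed


section \<open>Vector-space total orderings\<close>

locale vector_space_total_ordering =
  linorder le lt for le lt :: "'a::real_vector \<Rightarrow> 'a \<Rightarrow> bool" +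
  assumes add_right_mono: "le x y \<Longrightarrow> le (x + z) (y + z)"
    and scaleR_mono: "\<lbrakk>le x y; 0 \<le> r\<rbrakk> \<Longrightarrow> le (r *\<^sub>R x) (r *\<^sub>R y)"


section \<open>The orthogonal group and its action on the unit sphere\<close>

definition orthogonal_group :: "('a::real_inner \<Rightarrow> 'a) monoid"
  where "orthogonal_group = \<lparr>carrier = {f. orthogonal_transformation f}, mult = (\<circ>), one = id\<rparr>"

definition sphere_action :: "('a::real_inner \<Rightarrow> 'a) \<times> int \<Rightarrow> 'a \<Rightarrow> 'a"
  where "sphere_action = (\<lambda>(g, s). \<lambda>v\<in>sphere 0 1. of_int s *\<^sub>R g v)"

end

theory Submission
  imports Defs
begin

text \<open>
  A positive cone of a vector-space total ordering is lexicographic with respect to a unique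
  orthonormal basis, so the orthogonal group acts simply transitively on these cones. Hence the weak
  order consists of the biconvex subsets of \<open>\<Phi>\<^sup>+\<close>, i.e. the subsets that are convex and have convex
  complement: such a subset \<open>A\<close> yields the positive system \<open>(\<Phi>\<^sup>+ - A) \<union> - A\<close>. The hull of a union of
  biconvex sets is again biconvex, which gives joins, and the meet of a family is the join of its
  lower bounds. As \<open>\<Phi>\<^sup>+ - B\<close> is biconvex whenever \<open>B\<close> is, it bounds the join of any family of sets
  disjoint from \<open>B\<close>.
\<close>

section \<open>Orthonormal families\<close>

text \<open>The work is done with cones rather than subsets of the sphere: an open cone without 0 is
  determined by its trace on the sphere, and in a cone sums need no renormalising. Closure of
  biconvex sets under hulls is special to total cones. In the cone over an open square, the corners
  cut off at two opposite vertices are biconvex, but the complement of their hull falls into two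
  pieces. A total cone has non-Archimedean layers instead: a vector with an earlier leading
  coordinate absorbs every real multiple of one further down, and two vectors on the same layer have
  a combination at least one layer deeper. So the lexicographic basis serves twice, for moving one
  cone to another and for the hulls. The basis comes from repeated separation: within the orthogonal
  complement of the vectors already found, the cone contains an open half-space, whose unit normal
  is the next vector; the boundary hyperplane is left to the later vectors.\<close>

definition orthonormal :: "nat \<Rightarrow> (nat \<Rightarrow> 'a::real_inner) \<Rightarrow> bool"
  where "orthonormal n e \<longleftrightarrow> (\<forall>i<n. \<forall>j<n. e i \<bullet> e j = (if i = j then 1 else 0))"

text \<open>The condition \<open>perp n e = {0}\<close> expresses throughout that the family is a
  basis; the sets \<open>perp k e\<close> form the flag on which lexicographic comparison is read
  off.\<close>

definition perp :: "nat \<Rightarrow> (nat \<Rightarrow> 'a::real_inner) \<Rightarrow> 'a set"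
  where "perp n e = {x. \<forall>i<n. x \<bullet> e i = 0}"

lemma subspace_perp: "subspace (perp n e)"
  by (auto simp: perp_def subspace_def inner_add_left)

lemma orthonormal_inner:
  "orthonormal n e \<Longrightarrow> i < n \<Longrightarrow> j < n \<Longrightarrow> e i \<bullet> e j = (if i = j then 1 else 0)"
  by (simp add: orthonormal_def)

lemma inner_orthonormal_sum:
  assumes "orthonormal n e" "k < n"
  shows "(\<Sum>i<n. c i *\<^sub>R e i) \<bullet> e k = c k"
proof -
  have "(\<Sum>i<n. c i *\<^sub>R e i) \<bullet> e k = (\<Sum>i<n. if i = k then c i else 0)"
    unfolding inner_sum_left
    by (rule sum.cong) (use assms in \<open>auto simp: orthonormal_inner\<close>)
  then show ?thesis
    using assms(2) by simp
qed

lemma orthonormal_extend: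
  assumes "orthonormal n e" "a \<in> perp n e" "norm a = 1"
  shows "orthonormal (Suc n) (e(n := a))"
proof -
  have "a \<bullet> a = 1"
    using assms(3) by (simp add: norm_eq_1)
  then show ?thesis
    using assms(1,2) by (auto simp: orthonormal_def perp_def less_Suc_eq inner_commute)
qed

lemma orthonormal_expansion:
  assumes "orthonormal n e" "perp n e = {0}"
  shows "(\<Sum>i<n. (x \<bullet> e i) *\<^sub>R e i) = x"
proof -
  have "x - (\<Sum>i<n. (x \<bullet> e i) *\<^sub>R e i) \<in> perp n e"
    by (simp add: perp_def inner_diff_left inner_orthonormal_sum[OF assms(1)])
  then show ?thesis
    using assms(2) by simp
qed

lemma orthonormal_independent:
  assumes "orthonormal n e"
  shows "independent (e ` {..<n})" "card (e ` {..<n}) = n"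
proof -
  have "inj_on e {..<n}"
    by (rule inj_onI)
      (metis assms lessThan_iff orthonormal_inner zero_neq_one)
  then show "card (e ` {..<n}) = n"
    by (simp add: card_image)
  show "independent (e ` {..<n})"
  proof (rule pairwise_orthogonal_independent)
    show "pairwise orthogonal (e ` {..<n})"
      using assms by (auto simp: pairwise_def orthogonal_def orthonormal_def)
    show "0 \<notin> e ` {..<n}"
      using assms by (force simp: orthonormal_def)
  qed
qed

text \<open>For comparing the lengths of the lexicographic bases of two cones.\<close>

lemma orthonormal_complete_dim:
  assumes "orthonormal n (e :: nat \<Rightarrow> 'a::real_inner)" "perp n e = {0}"
  shows "dim (UNIV :: 'a set) = n"
proof (rule dim_unique[of "e ` {..<n}"])
  show "UNIV \<subseteq> span (e ` {..<n})"
  proof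
    fix x
    have "(\<Sum>i<n. (x \<bullet> e i) *\<^sub>R e i) \<in> span (e ` {..<n})"
      by (intro span_sum span_scale span_base) auto
    then show "x \<in> span (e ` {..<n})"
      by (simp add: orthonormal_expansion[OF assms])
  qed
qed (use orthonormal_independent[OF assms(1)] in auto)

text \<open>Bounds the greedy construction of a lexicographic basis. Finite dimension is known only
  through a spanning set, so a finite basis \<open>C\<close> is extracted first.\<close>

lemma orthonormal_le_dim:
  assumes "finite B" "span B = (UNIV :: 'a::real_inner set)" "orthonormal n (e :: nat \<Rightarrow> 'a)"
  shows "n \<le> dim (UNIV :: 'a set)"
proof -
  obtain C where C: "independent C" "span C = (UNIV :: 'a set)"
    using maximal_independent_subset[of UNIV] by (metis top.extremum_uniqueI)
  have "finite C"
    using independent_span_bound[OF assms(1) C(1)] assms(2) by simp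
  moreover have "card C = dim (UNIV :: 'a set)"
    using C by (metis dim_eq_card span_UNIV)
  ultimately show ?thesis
    using independent_span_bound[OF _ orthonormal_independent(1)[OF assms(3)], of C]
      orthonormal_independent(2)[OF assms(3)] C(2)
    by simp
qed

section \<open>Orthogonal maps of a finite-dimensional space\<close>

lemma orthogonal_transformation_orthonormal:
  assumes "orthogonal_transformation g" "orthonormal n e"
  shows "orthonormal n (g \<circ> e)"
  using assms by (simp add: orthonormal_def orthogonal_transformation_def)

lemma orthogonal_transformation_between:
  assumes "orthonormal n e" "perp n e = {0}" "orthonormal n f"
  obtains g where "orthogonal_transformation g" "\<And>i. i < n \<Longrightarrow> g (e i) = f i"
proof
  let ?g = "\<lambda>x. \<Sum>i<n. (x \<bullet> e i) *\<^sub>R f i"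
  have "linear ?g"
    by (intro linearI)
      (simp_all add: inner_add_left scaleR_add_left sum.distrib scaleR_sum_right)
  moreover have "?g v \<bullet> ?g w = v \<bullet> w" for v w
  proof -
    have "?g v \<bullet> ?g w = (\<Sum>i<n. (w \<bullet> e i) * (?g v \<bullet> f i))"
      by (subst inner_sum_right) simp
    also have "\<dots> = (\<Sum>i<n. (w \<bullet> e i) * (v \<bullet> e i))"
      by (simp add: inner_orthonormal_sum[OF assms(3)])
    also have "\<dots> = v \<bullet> (\<Sum>i<n. (w \<bullet> e i) *\<^sub>R e i)"
      by (simp add: inner_sum_right)
    finally show ?thesis
      by (simp add: orthonormal_expansion[OF assms(1,2)])
  qed
  ultimately show "orthogonal_transformation ?g"
    by (simp add: orthogonal_transformation_def)
  show "?g (e i) = f i" if "i < n" for i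
  proof -
    have "?g (e i) = (\<Sum>j<n. if j = i then f j else 0)"
      by (rule sum.cong) (use that assms(1) in \<open>auto simp: orthonormal_inner\<close>)
    then show ?thesis using that by simp
  qed
qed

lemma orthogonal_transformation_surj_fin:
  fixes g :: "'a::real_inner \<Rightarrow> 'a"
  assumes g: "orthogonal_transformation g" and B: "finite B" "span B = (UNIV :: 'a set)"
  shows "surj g"
proof -
  obtain C where C: "independent C" "span C = (UNIV :: 'a set)"
    using maximal_independent_subset[of UNIV] by (metis top.extremum_uniqueI)
  have "finite C"
    using independent_span_bound[OF B(1) C(1)] B(2) by simp
  interpret finite_dimensional_vector_space scaleR C
    by unfold_locales
      (use C \<open>finite C\<close> in \<open>simp_all add: dependent_raw_def span_raw_def\<close>)
  show ?thesis
    using linear_inj_imp_surj[of g] orthogonal_transformation_linear[OF g]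
      orthogonal_transformation_inj[OF g]
    by (simp add: linear_def)
qed

section \<open>Total cones\<close>

text \<open>Open refers to the strict bound on the scalars, not to a topology: 0 may be absent. The
  empty set counts, as it must to represent the inversion set of the identity.\<close>

definition open_cone :: "'a::real_vector set \<Rightarrow> bool"
  where "open_cone K \<longleftrightarrow>
    (\<forall>x\<in>K. \<forall>y\<in>K. x + y \<in> K) \<and> (\<forall>c>0. \<forall>x\<in>K. c *\<^sub>R x \<in> K)"

text \<open>The strictly positive vectors of a vector-space total ordering. Cones replace orderings
  so that orthogonal maps can act on them by images.\<close>

definition total_cone :: "'a::real_vector set \<Rightarrow> bool"
  where "total_cone Q \<longleftrightarrow> open_cone Q \<and> 0 \<notin> Q \<and> (\<forall>x. x \<noteq> 0 \<longrightarrow> x \<in> Q \<or> - x \<in> Q)"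

lemma open_cone_add: "open_cone K \<Longrightarrow> x \<in> K \<Longrightarrow> y \<in> K \<Longrightarrow> x + y \<in> K"
  by (simp add: open_cone_def)

lemma open_cone_scale: "open_cone K \<Longrightarrow> 0 < c \<Longrightarrow> x \<in> K \<Longrightarrow> c *\<^sub>R x \<in> K"
  by (simp add: open_cone_def)

lemma open_cone_scale_iff:
  assumes "open_cone K" "0 < c"
  shows "c *\<^sub>R x \<in> K \<longleftrightarrow> x \<in> K"
  using open_cone_scale[OF assms(1), of "inverse c" "c *\<^sub>R x"]
    open_cone_scale[OF assms, of x] assms(2) by auto

context
  fixes Q :: "'a::real_vector set"
  assumes Q: "total_cone Q"
begin

lemma total_cone_open_cone: "open_cone Q"
  using Q by (simp add: total_cone_def)

lemmas total_cone_add = open_cone_add[OF total_cone_open_cone]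
lemmas total_cone_scale = open_cone_scale[OF total_cone_open_cone]

lemma total_cone_zero: "0 \<notin> Q"
  using Q by (simp add: total_cone_def)

lemma total_cone_minus_iff: "x \<noteq> 0 \<Longrightarrow> - x \<in> Q \<longleftrightarrow> x \<notin> Q"
  using Q total_cone_add[of x "- x"] by (auto simp: total_cone_def)

lemma total_cone_minus: "x \<in> Q \<Longrightarrow> - x \<notin> Q"
  using total_cone_minus_iff[of x] total_cone_zero by metis

end

text \<open>\<open>u\<close> is an order unit of \<open>span B\<close>. Signs are chosen so that
  each \<open>m b\<close> is nonnegative; then \<open>u - m b\<close> is the sum of the other terms,
  so \<open>u\<close> bounds every element of \<open>B\<close>, and the vectors bounded by some
  multiple of \<open>u\<close> form a subspace.\<close>

lemma total_cone_order_unit: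
  fixes Q :: "'a::real_vector set"
  assumes Q: "total_cone Q" and "finite B"
  obtains u where "u \<in> Q \<or> u = 0" "u \<in> span B"
    "\<And>x. x \<in> span B \<Longrightarrow> \<exists>M. \<forall>t\<ge>M. t *\<^sub>R u - x \<in> Q \<union> {0} \<and> t *\<^sub>R u + x \<in> Q \<union> {0}"
proof -
  define m where "m b = (if b \<in> Q then b else - b)" for b
  define u where "u = (\<Sum>b\<in>B. m b)"
  have P_add: "x + y \<in> Q \<union> {0}" if "x \<in> Q \<union> {0}" "y \<in> Q \<union> {0}" for x y
    using that total_cone_add[OF Q] by auto
  have P_scale: "c *\<^sub>R x \<in> Q \<union> {0}" if "x \<in> Q \<union> {0}" "0 \<le> c" for x and c :: real
    using that total_cone_scale[OF Q, of c] by (cases "c = 0") auto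
  have m: "m b \<in> Q \<union> {0}" for b
    using total_cone_minus_iff[OF Q, of b] by (auto simp: m_def)
  have m_sum: "(\<Sum>b\<in>C. m b) \<in> Q \<union> {0}" if "finite C" for C
    using that
  proof (induction rule: finite_induct)
    case (insert b C)
    show ?case
      unfolding sum.insert[OF insert.hyps(1,2)] by (rule P_add[OF m insert.IH])
  qed simp
  then have u0: "u \<in> Q \<union> {0}"
    by (simp add: u_def \<open>finite B\<close>)
  define S where "S = {x. \<exists>M. \<forall>t\<ge>M. t *\<^sub>R u - x \<in> Q \<union> {0} \<and> t *\<^sub>R u + x \<in> Q \<union> {0}}"
  have SI: "x \<in> S" if M: "M *\<^sub>R u - x \<in> Q \<union> {0}" "M *\<^sub>R u + x \<in> Q \<union> {0}" for x M
  proof -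
    have "t *\<^sub>R u - x \<in> Q \<union> {0} \<and> t *\<^sub>R u + x \<in> Q \<union> {0}" if t: "t \<ge> M" for t
      using P_add[OF M(1) P_scale[OF u0, of "t - M"]]
        P_add[OF M(2) P_scale[OF u0, of "t - M"]] t
      by (simp add: algebra_simps)
    then show ?thesis
      by (auto simp: S_def)
  qed
  have SE: "\<exists>M. M *\<^sub>R u - x \<in> Q \<union> {0} \<and> M *\<^sub>R u + x \<in> Q \<union> {0}" if "x \<in> S" for x
    using that by (auto simp: S_def)
  have S: "subspace S"
  proof (rule subspaceI)
    show "0 \<in> S"
      by (rule SI[of 0]) auto
  next
    fix x y assume "x \<in> S" "y \<in> S"
    then obtain M N where M: "M *\<^sub>R u - x \<in> Q \<union> {0}" "M *\<^sub>R u + x \<in> Q \<union> {0}"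
      and N: "N *\<^sub>R u - y \<in> Q \<union> {0}" "N *\<^sub>R u + y \<in> Q \<union> {0}"
      using SE by meson
    have eqs: "(M + N) *\<^sub>R u - (x + y) = (M *\<^sub>R u - x) + (N *\<^sub>R u - y)"
      "(M + N) *\<^sub>R u + (x + y) = (M *\<^sub>R u + x) + (N *\<^sub>R u + y)"
      by (simp_all add: algebra_simps)
    show "x + y \<in> S"
      by (rule SI[of "M + N"]; unfold eqs; rule P_add[OF M(1) N(1)] P_add[OF M(2) N(2)])
  next
    fix c :: real and x assume "x \<in> S"
    then obtain M where M: "M *\<^sub>R u - x \<in> Q \<union> {0}" "M *\<^sub>R u + x \<in> Q \<union> {0}"
      using SE by meson
    have abs: "\<bar>c\<bar> *\<^sub>R (M *\<^sub>R u - x) \<in> Q \<union> {0}" "\<bar>c\<bar> *\<^sub>R (M *\<^sub>R u + x) \<in> Q \<union> {0}"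
      using P_scale[OF M(1)] P_scale[OF M(2)] abs_ge_zero by blast+
    show "c *\<^sub>R x \<in> S"
    proof (cases "0 \<le> c")
      case True
      with abs show ?thesis
        by (intro SI[of "c * M"]) (simp_all add: scaleR_diff_right scaleR_add_right)
    next
      case False
      with abs show ?thesis
        by (intro SI[of "- c * M"]) (simp_all add: scaleR_diff_right scaleR_add_right)
    qed
  qed
  have B_S: "b \<in> S" if "b \<in> B" for b
  proof -
    have "u - m b = (\<Sum>b\<in>B - {b}. m b)"
      using that \<open>finite B\<close> by (simp add: u_def sum_diff1)
    then have d: "u - m b \<in> Q \<union> {0}"
      using m_sum[of "B - {b}"] \<open>finite B\<close> by simp
    have "u + m b \<in> Q \<union> {0}"
      by (rule P_add[OF u0 m])
    with d have "m b \<in> S"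
      by (intro SI[of 1]) simp_all
    with subspace_neg[OF S this] show ?thesis
      by (auto simp: m_def split: if_splits)
  qed
  have "span B \<subseteq> S"
    using B_S S by (intro span_minimal) auto
  moreover have "u \<in> span B"
    unfolding u_def by (intro span_sum) (auto simp: m_def intro: span_base span_neg)
  ultimately show ?thesis
    using that[of u] u0 by (auto simp: S_def)
qed

lemma riesz_on_span:
  fixes f :: "'a::real_inner \<Rightarrow> real"
  assumes "finite B"
    and add: "\<And>x y. x \<in> span B \<Longrightarrow> y \<in> span B \<Longrightarrow> f (x + y) = f x + f y"
    and scale: "\<And>c x. x \<in> span B \<Longrightarrow> f (c *\<^sub>R x) = c * f x"
  obtains a where "a \<in> span B" "\<And>x. x \<in> span B \<Longrightarrow> x \<bullet> a = f x"
proof -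
  obtain C where C: "finite C" "span C = span B" "pairwise orthogonal C"
    using basis_orthogonal[OF assms(1)] by blast
  define a where "a = (\<Sum>c\<in>C. (f c / (c \<bullet> c)) *\<^sub>R c)"
  \<comment> \<open>\<open>C\<close> may contain 0, where the coefficient in \<open>a\<close>
    divides by 0; the required equation then reads 0 = \<open>f 0\<close>.\<close>
  have f0: "f 0 = 0"
    using scale[OF span_zero, of 0] by simp
  have "c \<bullet> a = f c" if c: "c \<in> C" for c
  proof -
    have "c \<bullet> a = (\<Sum>d\<in>C. if d = c then f c else 0)"
      unfolding a_def inner_sum_right
    proof (rule sum.cong)
      fix d assume "d \<in> C"
      then show "c \<bullet> ((f d / (d \<bullet> d)) *\<^sub>R d) = (if d = c then f c else 0)"
        using C(3) c f0 by (cases "c = 0") (auto simp: pairwise_def orthogonal_def)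
    qed simp
    then show ?thesis
      using c C(1) by simp
  qed
  then have "C \<subseteq> {x \<in> span B. x \<bullet> a = f x}"
    using C(2) span_superset by auto
  moreover have "subspace {x \<in> span B. x \<bullet> a = f x}"
    by (auto simp: subspace_def span_zero f0 add scale inner_add_left intro: span_add span_scale)
  ultimately have "span C \<subseteq> {x \<in> span B. x \<bullet> a = f x}"
    by (rule span_minimal)
  moreover have "a \<in> span C"
    unfolding a_def by (intro span_sum span_scale span_base)
  ultimately show ?thesis
    using that C(2) by blast
qed

text \<open>
  The supporting functional measures \<open>x\<close> against an order unit \<open>u\<close>: it is the Dedekind cut
  \<open>Sup {t. x - t u \<in> Q}\<close>.
\<close>

lemma total_cone_supporting_vector:
  fixes Q :: "'a::real_inner set"
  assumes Q: "total_cone Q" and "finite B" and "span B \<noteq> {0}"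
  obtains a where "a \<in> span B" "norm a = 1" "\<And>x. x \<in> span B \<Longrightarrow> 0 < x \<bullet> a \<Longrightarrow> x \<in> Q"
proof -
  obtain u where u: "u \<in> Q \<or> u = 0" "u \<in> span B"
    and unit: "\<And>x. x \<in> span B \<Longrightarrow>
      \<exists>M. \<forall>t\<ge>M. t *\<^sub>R u - x \<in> Q \<union> {0} \<and> t *\<^sub>R u + x \<in> Q \<union> {0}"
    using total_cone_order_unit[OF Q \<open>finite B\<close>] by metis
  note minus = total_cone_minus[OF Q]
  \<comment> \<open>If \<open>u\<close> were 0, its multiples would bound no vector but 0, forcing
    \<open>span B = {0}\<close>.\<close>
  have uQ: "u \<in> Q"
  proof (rule ccontr)
    assume "u \<notin> Q"
    then have "x = 0" if "x \<in> span B" for x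
      using unit[OF that] u(1) minus[of x] by auto
    with span_zero[of B] show False
      using assms(3) by blast
  qed
  have Q_add_u: "x + c *\<^sub>R u \<in> Q" if "x \<in> Q \<union> {0}" "0 < c" for x c
    using that total_cone_add[OF Q] total_cone_scale[OF Q _ uQ] by auto
  define T where "T x = {t. x - t *\<^sub>R u \<in> Q}" for x
  define f where "f x = Sup (T x)" for x
  have T: "T x \<noteq> {}" "bdd_above (T x)" if x: "x \<in> span B" for x
  proof -
    obtain M where M: "\<And>t. t \<ge> M \<Longrightarrow> t *\<^sub>R u - x \<in> Q \<union> {0} \<and> t *\<^sub>R u + x \<in> Q \<union> {0}"
      using unit[OF x] by blast
    have "- (M + 1) \<in> T x"
      using Q_add_u[of "M *\<^sub>R u + x" 1] M[of M] by (simp add: T_def algebra_simps)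
    then show "T x \<noteq> {}"
      by blast
    have "t \<le> M" if "t \<in> T x" for t
      using that M[of t] minus[of "x - t *\<^sub>R u"] total_cone_zero[OF Q]
      by (cases "t \<le> M") (auto simp: T_def)
    then show "bdd_above (T x)"
      by (auto simp: bdd_above_def)
  qed
  have below: "x - t *\<^sub>R u \<in> Q" if x: "x \<in> span B" and t: "t < f x" for x t
  proof -
    obtain s where "s \<in> T x" "t < s"
      using t T[OF x] less_cSup_iff[of "T x" t] by (auto simp: f_def)
    then show ?thesis
      using Q_add_u[of "x - s *\<^sub>R u" "s - t"] by (simp add: T_def algebra_simps)
  qed
  have above: "t *\<^sub>R u - x \<in> Q" if x: "x \<in> span B" and t: "f x < t" for x t
  proof -
    obtain s where s: "f x < s" "s < t"
      using t dense by blast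
    have "s \<notin> T x"
      using s(1) cSup_upper[OF _ T(2)[OF x], of s] by (auto simp: f_def)
    then have "s *\<^sub>R u - x \<in> Q \<union> {0}"
      using total_cone_minus_iff[OF Q, of "x - s *\<^sub>R u"] by (auto simp: T_def)
    then show ?thesis
      using Q_add_u[of "s *\<^sub>R u - x" "t - s"] s(2) by (simp add: algebra_simps)
  qed
  \<comment> \<open>Only one number can have both properties: a \<open>t\<close> strictly between
    two of them would put a vector and its negative into \<open>Q\<close>. Additivity and
    homogeneity then need no computation with suprema.\<close>
  have f_eqI: "f x = c" if x: "x \<in> span B" and "\<And>t. t < c \<Longrightarrow> x - t *\<^sub>R u \<in> Q"
    "\<And>t. c < t \<Longrightarrow> t *\<^sub>R u - x \<in> Q" for x c
  proof (rule linorder_cases[of "f x" c])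
    assume "f x < c"
    then obtain t where "f x < t" "t < c"
      using dense by blast
    then show ?thesis
      using above[OF x] that(2) minus[of "x - t *\<^sub>R u"] by simp
  next
    assume "c < f x"
    then obtain t where "c < t" "t < f x"
      using dense by blast
    then show ?thesis
      using below[OF x] that(3) minus[of "x - t *\<^sub>R u"] by simp
  qed
  have f_add: "f (x + y) = f x + f y" if x: "x \<in> span B" and y: "y \<in> span B" for x y
  proof (rule f_eqI)
    fix t assume "t < f x + f y"
    \<comment> \<open>The slack \<open>f x + f y - t\<close> is halved, so that the two cut points
      add up to \<open>t\<close>.\<close>
    then have "x - (f x - (f x + f y - t) / 2) *\<^sub>R u \<in> Q" "y - (f y - (f x + f y - t) / 2) *\<^sub>R u \<in> Q"
      by (auto intro!: below x y)
    from total_cone_add[OF Q this] show "x + y - t *\<^sub>R u \<in> Q"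
      by (simp add: algebra_simps flip: scaleR_add_left scaleR_diff_left)
  next
    fix t assume "f x + f y < t"
    then have "(f x + (t - f x - f y) / 2) *\<^sub>R u - x \<in> Q" "(f y + (t - f x - f y) / 2) *\<^sub>R u - y \<in> Q"
      by (auto intro!: above x y)
    from total_cone_add[OF Q this] show "t *\<^sub>R u - (x + y) \<in> Q"
      by (simp add: algebra_simps flip: scaleR_add_left scaleR_diff_left)
  qed (use x y in \<open>auto intro: span_add\<close>)
  have f_pos: "f (c *\<^sub>R x) = c * f x" if x: "x \<in> span B" and c: "0 < c" for x c
  proof (rule f_eqI)
    fix t assume "t < c * f x"
    then have "x - (t / c) *\<^sub>R u \<in> Q"
      using c by (intro below x) (simp add: field_simps)
    from total_cone_scale[OF Q c this] show "c *\<^sub>R x - t *\<^sub>R u \<in> Q"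
      using c by (simp add: algebra_simps)
  next
    fix t assume "c * f x < t"
    then have "(t / c) *\<^sub>R u - x \<in> Q"
      using c by (intro above x) (simp add: field_simps)
    from total_cone_scale[OF Q c this] show "t *\<^sub>R u - c *\<^sub>R x \<in> Q"
      using c by (simp add: algebra_simps)
  qed (use x in \<open>auto intro: span_scale\<close>)
  have f_0: "f 0 = 0"
    using f_add[of 0 0] by (simp add: span_zero)
  have f_minus: "f (- x) = - f x" if x: "x \<in> span B" for x
    using f_add[OF x span_neg[OF x]] f_0 by simp
  have f_scale: "f (c *\<^sub>R x) = c * f x" if x: "x \<in> span B" for x c
  proof (rule linorder_cases[of c 0])
    assume "c < 0"
    then show ?thesis
      using f_pos[of "- x" "- c"] x by (simp add: f_minus span_neg)
  qed (use x f_pos f_0 in auto)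
  \<comment> \<open>Shows that \<open>f\<close> is nonzero, so that \<open>a\<close> can be
    normalised.\<close>
  have "f u = 1"
  proof (rule f_eqI[OF u(2)])
    show "u - t *\<^sub>R u \<in> Q" if "t < 1" for t
      using that total_cone_scale[OF Q _ uQ, of "1 - t"] by (simp add: algebra_simps)
    show "t *\<^sub>R u - u \<in> Q" if "1 < t" for t
      using that total_cone_scale[OF Q _ uQ, of "t - 1"] by (simp add: algebra_simps)
  qed
  obtain a where a: "a \<in> span B" "\<And>x. x \<in> span B \<Longrightarrow> x \<bullet> a = f x"
    using riesz_on_span[OF \<open>finite B\<close> f_add f_scale] by blast
  have "a \<noteq> 0"
    using a(2)[OF u(2)] \<open>f u = 1\<close> by auto
  show ?thesis
  proof (rule that)
    show "a /\<^sub>R norm a \<in> span B" "norm (a /\<^sub>R norm a) = 1"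
      using a(1) \<open>a \<noteq> 0\<close> by (auto intro: span_scale)
    show "x \<in> Q" if "x \<in> span B" "0 < x \<bullet> (a /\<^sub>R norm a)" for x
    proof -
      have "0 < f x"
        using that \<open>a \<noteq> 0\<close> a(2) by (simp add: zero_less_mult_iff)
      then show ?thesis
        using below[OF that(1), of 0] by simp
    qed
  qed
qed

text \<open>The vectors whose first nonzero coordinate along \<open>e\<close> is positive.\<close>

definition lex_pos :: "nat \<Rightarrow> (nat \<Rightarrow> 'a::real_inner) \<Rightarrow> 'a set"
  where "lex_pos n e = {x. \<exists>k<n. 0 < x \<bullet> e k \<and> x \<in> perp k e}"

text \<open>A longest orthonormal family with lexicographic cone inside \<open>Q\<close> exists
  because the dimension bounds its length; were it incomplete, a supporting vector of
  \<open>Q\<close> in \<open>perp n e\<close> would prolong it. For a basis the inclusion is an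
  equality, since every nonzero vector or its negative is lexicographically positive.\<close>

lemma total_cone_lex_basis:
  fixes Q :: "'a::real_inner set"
  assumes Q: "total_cone Q" and B: "finite B" "span B = (UNIV :: 'a set)"
  obtains e :: "nat \<Rightarrow> 'a" and n where "orthonormal n e" "perp n e = {0}" "Q = lex_pos n e"
proof -
  define partial where "partial n e \<longleftrightarrow> orthonormal n e \<and> lex_pos n e \<subseteq> Q" for n and e :: "nat \<Rightarrow> 'a"
  have "\<exists>e. partial 0 e"
    by (simp add: partial_def orthonormal_def lex_pos_def)
  moreover have "\<forall>n. (\<exists>e. partial n e) \<longrightarrow> n \<le> dim (UNIV :: 'a set)"
    using orthonormal_le_dim[OF B] by (auto simp: partial_def)
  ultimately obtain n where n: "\<exists>e. partial n e" and max: "\<And>m. \<exists>e. partial m e \<Longrightarrow> m \<le> n"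
    using Nat.ex_has_greatest_nat[of "\<lambda>n. \<exists>e. partial n e" 0] by blast
  from n obtain e where e: "orthonormal n e" "lex_pos n e \<subseteq> Q"
    by (auto simp: partial_def)
  have complete: "perp n e = {0}"
  proof (rule ccontr)
    assume ne: "perp n e \<noteq> {0}"
    obtain C where C: "C \<subseteq> perp n e" "independent C" "perp n e \<subseteq> span C"
      using maximal_independent_subset by blast
    have span: "span C = perp n e"
      using C span_minimal[OF C(1) subspace_perp] by blast
    have "finite C"
      using independent_span_bound[OF B(1) C(2)] B(2) by simp
    with total_cone_supporting_vector[OF Q, of C] obtain a
      where a: "a \<in> perp n e" "norm a = 1" "\<And>x. x \<in> perp n e \<Longrightarrow> 0 < x \<bullet> a \<Longrightarrow> x \<in> Q"
      unfolding span using ne by metis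
    have "perp k (e(n := a)) = perp k e" if "k \<le> n" for k
      using that by (simp add: perp_def)
    then have "lex_pos (Suc n) (e(n := a)) \<subseteq> lex_pos n e \<union> {x \<in> perp n e. 0 < x \<bullet> a}"
      by (auto simp: lex_pos_def less_Suc_eq)
    then have "lex_pos (Suc n) (e(n := a)) \<subseteq> Q"
      using e(2) a(3) by blast
    then have "partial (Suc n) (e(n := a))"
      using orthonormal_extend[OF e(1) a(1,2)] by (simp add: partial_def)
    then show False
      using max[of "Suc n"] by auto
  qed
  have "Q \<subseteq> lex_pos n e"
  proof
    fix x assume x: "x \<in> Q"
    then have "x \<notin> perp n e"
      using complete total_cone_zero[OF Q] by auto
    then have ex: "\<exists>k. k < n \<and> x \<bullet> e k \<noteq> 0"
      by (auto simp: perp_def)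
    define k where "k = (LEAST k. k < n \<and> x \<bullet> e k \<noteq> 0)"
    have k: "k < n" "x \<bullet> e k \<noteq> 0"
      using LeastI_ex[OF ex] by (auto simp: k_def)
    have "x \<bullet> e i = 0" if "i < k" for i
      using not_less_Least[of i "\<lambda>k. k < n \<and> x \<bullet> e k \<noteq> 0"] that k(1) by (auto simp: k_def)
    then have p: "x \<in> perp k e"
      by (simp add: perp_def)
    have "\<not> x \<bullet> e k < 0"
    proof
      assume "x \<bullet> e k < 0"
      then have "- x \<in> lex_pos n e"
        using k(1) p by (auto simp: lex_pos_def intro: subspace_neg[OF subspace_perp])
      then show False
        using x e(2) total_cone_minus[OF Q] by blast
    qed
    then show "x \<in> lex_pos n e"
      using k p by (auto simp: lex_pos_def)
  qed
  with that[OF e(1) complete] e(2) show ?thesis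
    by blast
qed

text \<open>At the first index where the bases differ, \<open>e i - f i\<close> is orthogonal to all
  earlier vectors, and its inner product with \<open>e i\<close>, like that of its negative with
  \<open>f i\<close>, is half its squared norm. So it and its negative would both lie in
  \<open>Q\<close>.\<close>

lemma lex_basis_unique:
  assumes Q: "total_cone Q"
    and e: "orthonormal n e" "lex_pos n e = Q" and f: "orthonormal n f" "lex_pos n f = Q"
    and "i < n"
  shows "e i = f i"
  using \<open>i < n\<close>
proof (induction i rule: less_induct)
  case (less i)
  have norm: "e i \<bullet> e i = 1" "f i \<bullet> f i = 1"
    using less.prems e(1) f(1) by (auto simp: orthonormal_inner)
  let ?x = "e i - f i"
  have *: "0 < ?x \<bullet> ?x \<Longrightarrow> ?x \<bullet> e i > 0" "0 < ?x \<bullet> ?x \<Longrightarrow> - ?x \<bullet> f i > 0"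
    using norm by (simp_all add: inner_diff_left inner_diff_right inner_commute)
  have "e i \<bullet> e j = 0" "f i \<bullet> f j = 0" "e j = f j" if "j < i" for j
    using that less.prems orthonormal_inner[OF e(1), of i j] orthonormal_inner[OF f(1), of i j]
      less.IH[of j] by simp_all
  then have "?x \<bullet> e j = 0" "- ?x \<bullet> f j = 0" if "j < i" for j
    using that by (simp_all add: inner_diff_left)
  then have perp: "?x \<in> perp i e" "- ?x \<in> perp i f"
    unfolding perp_def by blast+
  show ?case
  proof (rule ccontr)
    assume "e i \<noteq> f i"
    then have "?x \<in> lex_pos n e" "- ?x \<in> lex_pos n f"
      using * perp less.prems by (auto simp: lex_pos_def)
    then show False
      using total_cone_minus[OF Q] e(2) f(2) by blast
  qed
qed

section \<open>Biconvex cones\<close>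

definition biconvex :: "'a::real_vector set \<Rightarrow> 'a set \<Rightarrow> bool"
  where "biconvex P K \<longleftrightarrow> K \<subseteq> P \<and> open_cone K \<and> open_cone (P - K)"

lemma biconvex_compl: "biconvex P K \<Longrightarrow> biconvex P (P - K)"
  by (auto simp: biconvex_def double_diff)

text \<open>The cone version of an inversion set: when \<open>Q\<close> is the image of
  \<open>P\<close> under \<open>g\<close>, its trace on the sphere is the inversion set of
  \<open>g\<close>.\<close>

definition inversions :: "'a::real_vector set \<Rightarrow> 'a set \<Rightarrow> 'a set"
  where "inversions P Q = {x \<in> P. - x \<in> Q}"

text \<open>Inside \<open>P\<close>, a vector avoids the negative of \<open>Q\<close> exactly when
  it lies in \<open>Q\<close>, so the complement is \<open>P \<inter> Q\<close>, an intersection of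
  cones.\<close>

lemma biconvex_inversions:
  assumes P: "total_cone P" and Q: "total_cone Q"
  shows "biconvex P (inversions P Q)"
proof -
  have "- x \<in> Q \<longleftrightarrow> x \<notin> Q" if "x \<in> P" for x
    using total_cone_minus_iff[OF Q, of x] total_cone_zero[OF P] that by metis
  then have "P - inversions P Q = P \<inter> Q"
    by (auto simp: inversions_def)
  moreover have "open_cone (inversions P Q)"
    unfolding open_cone_def
  proof (intro conjI ballI allI impI)
    fix x y assume "x \<in> inversions P Q" "y \<in> inversions P Q"
    then show "x + y \<in> inversions P Q"
      using total_cone_add[OF P, of x y] total_cone_add[OF Q, of "- x" "- y"]
      by (simp add: inversions_def)
  next
    fix c :: real and x assume "0 < c" "x \<in> inversions P Q"
    then show "c *\<^sub>R x \<in> inversions P Q"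
      using total_cone_scale[OF P, of c x] total_cone_scale[OF Q, of c "- x"]
      by (simp add: inversions_def)
  qed
  moreover have "open_cone (P \<inter> Q)"
    using total_cone_open_cone[OF P] total_cone_open_cone[OF Q] by (simp add: open_cone_def)
  ultimately show ?thesis
    by (simp add: biconvex_def inversions_def)
qed

lemma total_cone_of_biconvex:
  assumes P: "total_cone P" and K: "biconvex P K"
  obtains Q where "total_cone Q" "K = inversions P Q"
proof
  have KP: "K \<subseteq> P" and cK: "open_cone K" and cPK: "open_cone (P - K)"
    using K by (auto simp: biconvex_def)
  define Q where "Q = (P - K) \<union> uminus ` K"
  have mem_Q: "x \<in> Q \<longleftrightarrow> x \<in> P - K \<or> - x \<in> K" for x
    unfolding Q_def by (metis (no_types, lifting) Un_iff add.inverse_inverse image_iff)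
  have zero: "0 \<notin> Q"
    using total_cone_zero[OF P] KP by (auto simp: mem_Q)
  have total: "x \<in> Q \<or> - x \<in> Q" if "x \<noteq> 0" for x
    using that total_cone_minus_iff[OF P, of x] KP by (auto simp: mem_Q)
  \<comment> \<open>The only sums not covered by the two cone hypotheses. Otherwise the negative of
    \<open>x + y\<close> is in \<open>Q\<close>: either adding \<open>x\<close> to
    \<open>- (x + y)\<close> puts \<open>- y\<close> into \<open>P - K\<close>, or adding
    \<open>- y\<close> to \<open>x + y\<close> puts \<open>x\<close> into \<open>K\<close>.\<close>
  have mixed: "x + y \<in> Q" if x: "x \<in> P - K" and y: "- y \<in> K" for x y
  proof (rule ccontr)
    assume nQ: "x + y \<notin> Q"
    then have "x + y \<noteq> 0"
      using x y by (metis DiffD2 add.inverse_unique add.commute add.inverse_inverse)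
    with total nQ have "- (x + y) \<in> Q"
      by blast
    then consider "- (x + y) \<in> P - K" | "x + y \<in> K"
      using mem_Q[of "- (x + y)"] unfolding minus_minus by blast
    then show False
    proof cases
      case 1
      then show False
        using open_cone_add[OF cPK 1 x] y by simp
    next
      case 2
      then show False
        using open_cone_add[OF cK 2 y] x by simp
    qed
  qed
  have "x + y \<in> Q" if "x \<in> Q" "y \<in> Q" for x y
    using that mixed[of x y] mixed[of y x] open_cone_add[OF cPK, of x y]
      open_cone_add[OF cK, of "- x" "- y"]
    by (auto simp: mem_Q add.commute)
  moreover have "c *\<^sub>R x \<in> Q" if "x \<in> Q" "0 < c" for x c
    using that open_cone_scale[OF cPK, of c x] open_cone_scale[OF cK, of c "- x"]
    by (auto simp: mem_Q)
  ultimately show "total_cone Q"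
    using zero total by (auto simp: total_cone_def open_cone_def)
  show "K = inversions P Q"
    using KP total_cone_minus[OF P] by (auto simp: inversions_def mem_Q)
qed

subsection \<open>Joins\<close>

text \<open>Only sums are generated: a union of cones is closed under positive scaling, and its hull
  inherits this. Inductions over the hull then have a single step, for sums.\<close>

inductive_set additive_hull :: "'a::plus set \<Rightarrow> 'a set" for S
  where
    base: "x \<in> S \<Longrightarrow> x \<in> additive_hull S"
  | add: "x \<in> additive_hull S \<Longrightarrow> y \<in> additive_hull S \<Longrightarrow> x + y \<in> additive_hull S"

lemma additive_hull_minimal:
  assumes "S \<subseteq> T" "open_cone T"
  shows "additive_hull S \<subseteq> T"
proof
  fix x assume "x \<in> additive_hull S"
  then show "x \<in> T"
    by induction (use assms in \<open>auto intro: open_cone_add\<close>)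
qed

lemma open_cone_additive_hull:
  assumes "\<And>c x. 0 < c \<Longrightarrow> x \<in> S \<Longrightarrow> c *\<^sub>R x \<in> S"
  shows "open_cone (additive_hull S)"
proof -
  have "c *\<^sub>R x \<in> additive_hull S" if "x \<in> additive_hull S" "0 < c" for c x
    using that by induction (auto simp: scaleR_add_right intro: assms additive_hull.intros)
  then show ?thesis
    by (auto simp: open_cone_def intro: additive_hull.add)
qed

text \<open>In the ordering with positive cone \<open>P\<close>, \<open>x\<close> exceeds every real
  multiple of \<open>p\<close>, so \<open>p\<close> is infinitesimal beside \<open>x\<close>. The
  weaker condition that \<open>x - p\<close> is in \<open>P\<close> would not pass from a sum to a
  summand.\<close>

definition dominates :: "'a::real_vector set \<Rightarrow> 'a \<Rightarrow> 'a \<Rightarrow> bool"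
  where "dominates P x p \<longleftrightarrow> (\<forall>c. x - c *\<^sub>R p \<in> P)"

text \<open>If neither summand dominated \<open>p\<close>, then \<open>x\<close> would be at most
  \<open>c\<close> times \<open>p\<close> and \<open>y\<close> at most \<open>d\<close> times
  \<open>p\<close>, so \<open>x + y\<close> would be at most \<open>c + d\<close> times
  \<open>p\<close>.\<close>

lemma dominates_add_cases:
  assumes P: "total_cone P" and xy: "dominates P (x + y) p"
  shows "dominates P x p \<or> dominates P y p"
proof (rule ccontr)
  assume "\<not> ?thesis"
  then obtain c d where "x - c *\<^sub>R p \<notin> P" "y - d *\<^sub>R p \<notin> P"
    by (auto simp: dominates_def)
  then have "x - c *\<^sub>R p = 0 \<or> - (x - c *\<^sub>R p) \<in> P" "y - d *\<^sub>R p = 0 \<or> - (y - d *\<^sub>R p) \<in> P"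
    using total_cone_minus_iff[OF P] by blast+
  then have "- (x - c *\<^sub>R p) + - (y - d *\<^sub>R p) \<in> P \<union> {0}"
    using total_cone_add[OF P] by (metis UnCI add.left_neutral add.right_neutral minus_zero singletonI)
  moreover have "- (x - c *\<^sub>R p) + - (y - d *\<^sub>R p) = - (x + y - (c + d) *\<^sub>R p)"
    by (simp add: algebra_simps)
  ultimately have "- (x + y - (c + d) *\<^sub>R p) \<in> P \<union> {0}"
    by metis
  moreover have "x + y - (c + d) *\<^sub>R p \<in> P"
    using xy by (simp add: dominates_def)
  ultimately show False
    using total_cone_minus[OF P] total_cone_zero[OF P]
    by (metis Un_iff singletonD neg_equal_0_iff_equal)
qed

text \<open>
  Every biconvex cone that contains \<open>x\<close> but not \<open>p\<close> contains \<open>x - p\<close>, and this survives in the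
  hull because a sum dominates \<open>p\<close> only if one of its summands does.
\<close>

lemma additive_hull_diff_dominated:
  assumes P: "total_cone P" and S: "\<And>K. K \<in> \<K> \<Longrightarrow> biconvex P K"
    and "x \<in> additive_hull (\<Union>\<K>)" "p \<in> P" "p \<notin> additive_hull (\<Union>\<K>)" "dominates P x p"
  shows "x - p \<in> additive_hull (\<Union>\<K>)"
  using assms(3,6)
proof induction
  case (base x)
  then obtain K where K: "K \<in> \<K>" "x \<in> K"
    by blast
  have "x - p \<in> P"
    using base.prems by (metis dominates_def scaleR_one)
  moreover have "p \<in> P - K"
    using assms(4,5) K(1) by (auto intro: additive_hull.base)
  moreover have "open_cone (P - K)"
    using S[OF K(1)] by (simp add: biconvex_def)
  ultimately have "x - p \<in> K"
    using open_cone_add[of "P - K" "x - p" p] K(2) by auto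
  then show ?case
    using K(1) by (auto intro: additive_hull.base)
next
  case (add x y)
  from dominates_add_cases[OF P add.prems] show ?case
  proof
    assume "dominates P x p"
    then have "(x - p) + y \<in> additive_hull (\<Union>\<K>)"
      by (intro additive_hull.add add)
    then show ?thesis
      by (simp add: algebra_simps)
  next
    assume "dominates P y p"
    then have "x + (y - p) \<in> additive_hull (\<Union>\<K>)"
      by (intro additive_hull.add add)
    then show ?thesis
      by (simp add: algebra_simps)
  qed
qed

text \<open>Subtracting a multiple of \<open>p\<close> changes no coordinate of \<open>x\<close> up
  to and including the leading one.\<close>

lemma lex_pos_dominates:
  assumes "k < n" "x \<in> perp k e" "0 < x \<bullet> e k" "p \<in> perp (Suc k) e"
  shows "dominates (lex_pos n e) x p"
proof -
  have "x - c *\<^sub>R p \<in> perp k e \<and> 0 < (x - c *\<^sub>R p) \<bullet> e k" for c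
    using assms(2-4) by (auto simp: perp_def inner_diff_left)
  then show ?thesis
    using assms(1) by (auto simp: dominates_def lex_pos_def)
qed

text \<open>
  For \<open>u\<close> and \<open>v\<close> outside the hull \<open>C\<close> compare leading coordinates \<open>a\<close> and \<open>b\<close>. If one element
  dominates the other, subtracting the smaller one from \<open>u + v \<in> C\<close> yields the larger one. Otherwise
  \<open>d = b u - a v\<close> is dominated by \<open>u\<close> and \<open>v\<close>: adding a multiple of \<open>d\<close> to \<open>u + v\<close> gives a multiple of
  \<open>u\<close>, subtracting one gives a multiple of \<open>v\<close>, and one of the two moves stays in \<open>C\<close>.
\<close>

lemma biconvex_additive_hull:
  assumes P: "total_cone P" and S: "\<And>K. K \<in> \<K> \<Longrightarrow> biconvex P K"
    and e: "P = lex_pos n e" "perp n e = {0}"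
  shows "biconvex P (additive_hull (\<Union>\<K>))"
proof -
  let ?C = "additive_hull (\<Union>\<K>)"
  have "K \<subseteq> P" if "K \<in> \<K>" for K
    using S[OF that] by (simp add: biconvex_def)
  then have CP: "?C \<subseteq> P"
    by (intro additive_hull_minimal total_cone_open_cone[OF P]) blast
  have C: "open_cone ?C"
    by (rule open_cone_additive_hull) (use S in \<open>auto simp: biconvex_def intro: open_cone_scale\<close>)
  note scale_iff = open_cone_scale_iff[OF C]
  note diff = additive_hull_diff_dominated[OF P S]
  have dominated: False
    if u: "u \<in> P - ?C" and v: "v \<in> P - ?C" and uv: "u + v \<in> ?C"
      and k: "k < n" "u \<in> perp k e" "0 < u \<bullet> e k" "v \<in> perp (Suc k) e" for u v k
  proof -
    have "u + v \<in> perp k e" "0 < (u + v) \<bullet> e k"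
      using k by (auto simp: perp_def inner_add_left)
    then have "dominates P (u + v) v"
      unfolding e(1) using k by (intro lex_pos_dominates)
    with diff[OF _ uv, of v] u v show False
      by auto
  qed
  have comparable: False
    if u: "u \<in> P - ?C" and v: "v \<in> P - ?C" and uv: "u + v \<in> ?C"
      and k: "k < n" "u \<in> perp k e" "0 < u \<bullet> e k" "v \<in> perp k e" "0 < v \<bullet> e k"
      and d: "(v \<bullet> e k) *\<^sub>R u - (u \<bullet> e k) *\<^sub>R v \<in> P \<union> {0}" for u v k
  proof -
    define a b where "a = u \<bullet> e k" and "b = v \<bullet> e k"
    have ab: "0 < a" "0 < b"
      using k by (simp_all add: a_def b_def)
    define d where "d = b *\<^sub>R u - a *\<^sub>R v"
    have u_eq: "a *\<^sub>R (u + v) + d = (a + b) *\<^sub>R u" and v_eq: "b *\<^sub>R (u + v) - d = (a + b) *\<^sub>R v"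
      by (simp_all add: d_def algebra_simps)
    have d_perp: "d \<in> perp (Suc k) e"
      using k by (auto simp: d_def a_def b_def perp_def inner_diff_left less_Suc_eq)
    have sum_C: "a *\<^sub>R (u + v) \<in> ?C" "b *\<^sub>R (u + v) \<in> ?C"
      using open_cone_scale[OF C _ uv] ab by blast+
    have not_C: "(a + b) *\<^sub>R u \<notin> ?C" "(a + b) *\<^sub>R v \<notin> ?C"
      using u v ab by (simp_all add: scale_iff)
    \<comment> \<open>Otherwise \<open>u_eq\<close> would make a positive multiple of
      \<open>u\<close> equal to one of \<open>u + v\<close>, which lies in the hull.\<close>
    have "d \<noteq> 0"
      using u_eq sum_C(1) not_C(1) by (metis add.right_neutral)
    then have dP: "d \<in> P"
      using d by (simp add: d_def a_def b_def)
    show False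
    proof (cases "d \<in> ?C")
      case True
      with u_eq sum_C(1) not_C(1) show False
        by (metis additive_hull.add)
    next
      case False
      have "b *\<^sub>R (u + v) \<in> perp k e" "0 < (b *\<^sub>R (u + v)) \<bullet> e k"
        using k ab by (auto simp: perp_def inner_add_left intro: mult_pos_pos add_pos_pos)
      then have "dominates P (b *\<^sub>R (u + v)) d"
        unfolding e(1) using k(1) d_perp by (intro lex_pos_dominates)
      from diff[OF _ sum_C(2) dP False this] v_eq not_C(2) show False
        by simp
    qed
  qed
  have "u + v \<notin> ?C" if u: "u \<in> P - ?C" and v: "v \<in> P - ?C" for u v
  proof
    assume uv: "u + v \<in> ?C"
    obtain i where i: "i < n" "0 < u \<bullet> e i" "u \<in> perp i e"
      using u by (auto simp: e(1) lex_pos_def)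
    obtain j where j: "j < n" "0 < v \<bullet> e j" "v \<in> perp j e"
      using v by (auto simp: e(1) lex_pos_def)
    have perp_mono: "x \<in> perp (Suc k) e" if "x \<in> perp l e" "k < l" for x k l
      using that by (auto simp: perp_def)
    consider "i < j" | "j < i" | "i = j"
      by linarith
    then show False
    proof cases
      case 1
      then show False
        using dominated[OF u v uv i(1,3,2)] perp_mono[OF j(3)] by blast
    next
      case 2
      then show False
        using dominated[OF v u _ j(1,3,2)] perp_mono[OF i(3)] uv by (simp add: add.commute)
    next
      case 3
      let ?d = "(v \<bullet> e i) *\<^sub>R u - (u \<bullet> e i) *\<^sub>R v"
      \<comment> \<open>Exchanging \<open>u\<close> and \<open>v\<close> negates \<open>?d\<close>,
        so one of the two orders meets the sign condition of \<open>comparable\<close>.\<close>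
      have "?d \<in> P \<union> {0} \<or> - ?d \<in> P \<union> {0}"
        using total_cone_minus_iff[OF P, of ?d] by blast
      then show False
        using comparable[OF u v uv i(1,3,2)] comparable[OF v u _ i(1)] i j 3 uv
        by (auto simp: add.commute)
    qed
  qed
  moreover have "c *\<^sub>R u \<in> P - ?C" if "u \<in> P - ?C" "0 < c" for u c
    using that total_cone_scale[OF P] scale_iff by blast
  ultimately have "open_cone (P - ?C)"
    using total_cone_add[OF P] by (auto simp: open_cone_def)
  then show ?thesis
    using CP C by (simp add: biconvex_def)
qed

section \<open>The orthogonal group and total cones\<close>

lemma (in vector_space_total_ordering) total_cone_positive: "total_cone {x. lt 0 x}"
proof -
  have "lt 0 (x + y)" if x: "lt 0 x" and y: "lt 0 y" for x y
  proof -
    have "le y (x + y)"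
      using add_right_mono[OF less_imp_le[OF x], of y] by simp
    with y show ?thesis
      by (rule less_le_trans)
  qed
  moreover have "lt 0 (c *\<^sub>R x)" if x: "lt 0 x" and c: "0 < c" for x and c :: real
  proof -
    have "le 0 (c *\<^sub>R x)"
      using scaleR_mono[OF less_imp_le[OF x], of c] c by simp
    moreover have "c *\<^sub>R x \<noteq> 0"
      using x c less_irrefl by auto
    ultimately show ?thesis
      by (metis le_neq_trans)
  qed
  moreover have "lt 0 x \<or> lt 0 (- x)" if "x \<noteq> 0" for x
  proof (rule disjCI)
    assume "\<not> lt 0 (- x)"
    then have "le (- x) 0"
      by (metis not_less)
    from add_right_mono[OF this, of x] have "le 0 x"
      by simp
    with that show "lt 0 x"
      by (metis le_neq_trans)
  qed
  moreover have "\<not> lt 0 0"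
    by (rule less_irrefl)
  ultimately show ?thesis
    by (simp add: total_cone_def open_cone_def)
qed

lemma image_lex_pos:
  assumes "orthogonal_transformation g" "surj g"
  shows "g ` lex_pos n e = lex_pos n (g \<circ> e)"
proof -
  have "g x \<in> lex_pos n (g \<circ> e) \<longleftrightarrow> x \<in> lex_pos n e" for x
    using assms(1) by (simp add: lex_pos_def perp_def orthogonal_transformation_def)
  then have "g ` {x. g x \<in> lex_pos n (g \<circ> e)} = g ` lex_pos n e"
    by simp
  then show ?thesis
    using assms(2) by (simp add: surj_image_vimage_eq flip: vimage_def)
qed

lemma lex_pos_cong:
  assumes "\<And>i. i < n \<Longrightarrow> e i = f i"
  shows "lex_pos n e = lex_pos n f"
proof -
  have "k < n \<Longrightarrow> perp k e = perp k f" for k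
    using assms by (simp add: perp_def)
  then show ?thesis
    using assms by (auto simp: lex_pos_def)
qed

lemma total_cone_image:
  assumes P: "total_cone P" and g: "orthogonal_transformation g" "surj g"
  shows "total_cone (g ` P)"
proof -
  have lin: "linear g"
    using g(1) by (rule orthogonal_transformation_linear)
  have mem: "g x \<in> g ` P \<longleftrightarrow> x \<in> P" for x
    using orthogonal_transformation_inj[OF g(1)] by (simp add: inj_image_mem_iff)
  have "y \<in> g ` P \<or> - y \<in> g ` P" if "y \<noteq> 0" for y
  proof -
    obtain x where x: "y = g x"
      using g(2) by blast
    then have "x \<noteq> 0"
      using that lin by (auto simp: linear_0)
    then show ?thesis
      using total_cone_minus_iff[OF P] mem[of x] mem[of "- x"] lin x by (auto simp: linear_neg)
  qed
  moreover have "0 \<notin> g ` P"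
    using mem[of 0] total_cone_zero[OF P] lin by (simp add: linear_0)
  moreover have "open_cone (g ` P)"
    using total_cone_add[OF P] total_cone_scale[OF P]
    by (auto simp: open_cone_def simp flip: linear_add[OF lin] linear_scale[OF lin])
  ultimately show ?thesis
    by (simp add: total_cone_def)
qed

section \<open>Simple transitivity on total cones\<close>

context
  fixes P B :: "'a::real_inner set"
  assumes P: "total_cone P" and B: "finite B" "span B = (UNIV :: 'a set)"
begin

lemma total_cone_conjugate:
  fixes Q :: "'a set"
  assumes Q: "total_cone Q"
  obtains g where "orthogonal_transformation g" "Q = g ` P"
proof -
  obtain e n where e: "orthonormal n e" "perp n e = {0}" "P = lex_pos n e"
    using total_cone_lex_basis[OF P B] by blast
  obtain f m where f: "orthonormal m f" "perp m f = {0}" "Q = lex_pos m f"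
    using total_cone_lex_basis[OF Q B] by blast
  have "m = n"
    using orthonormal_complete_dim[OF e(1,2)] orthonormal_complete_dim[OF f(1,2)] by simp
  then obtain g where g: "orthogonal_transformation g" "\<And>i. i < n \<Longrightarrow> g (e i) = f i"
    using orthogonal_transformation_between[OF e(1,2)] f(1) by blast
  have "g ` P = lex_pos n (g \<circ> e)"
    using image_lex_pos[OF g(1) orthogonal_transformation_surj_fin[OF g(1) B]] e(3) by simp
  also have "\<dots> = Q"
    unfolding f(3) \<open>m = n\<close> by (rule lex_pos_cong) (simp add: g(2))
  finally show ?thesis
    using that g(1) by blast
qed

text \<open>The family \<open>g \<circ> e\<close> is again a lexicographic basis of
  \<open>P\<close>, so uniqueness makes \<open>g\<close> fix every \<open>e i\<close>.\<close>

lemma total_cone_stabilizer_trivial: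
  assumes g: "orthogonal_transformation g" "g ` P = P"
  shows "g = id"
proof
  fix x
  obtain e n where e: "orthonormal n e" "perp n e = {0}" "P = lex_pos n e"
    using total_cone_lex_basis[OF P B] by blast
  have "lex_pos n (g \<circ> e) = P"
    using image_lex_pos[OF g(1) orthogonal_transformation_surj_fin[OF g(1) B]] e(3) g(2) by metis
  then have "g (e i) = e i" if "i < n" for i
    using lex_basis_unique[OF P orthogonal_transformation_orthonormal[OF g(1) e(1)] _ e(1)
        e(3)[symmetric] that] by simp
  then have "g (\<Sum>i<n. (x \<bullet> e i) *\<^sub>R e i) = (\<Sum>i<n. (x \<bullet> e i) *\<^sub>R e i)"
    using orthogonal_transformation_linear[OF g(1)] by (simp add: linear_sum linear_scale)
  then show "g x = id x"
    by (simp add: orthonormal_expansion[OF e(1,2)])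
qed

end

text \<open>A total cone contains exactly one of \<open>x\<close> and \<open>- x\<close> for nonzero
  \<open>x\<close>, so an inclusion between total cones is an equality.\<close>

lemma inversions_eq_empty:
  assumes P: "total_cone P" and Q: "total_cone Q" and "inversions P Q = {}"
  shows "Q = P"
proof
  have *: "- x \<notin> Q" if "x \<in> P" for x
    using that assms(3) by (auto simp: inversions_def)
  show "P \<subseteq> Q"
    using * total_cone_minus_iff[OF Q] total_cone_zero[OF P] by (metis subsetI)
  show "Q \<subseteq> P"
  proof
    fix x assume "x \<in> Q"
    then show "x \<in> P"
      using *[of "- x"] total_cone_minus_iff[OF P, of x] total_cone_zero[OF Q] by auto
  qed
qed

text \<open>Every vector of \<open>K\<close> can be normalised inside \<open>K\<close> and scaled
  back inside \<open>L\<close>. This carries inclusions from the weak order over to cones.\<close>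

lemma open_cone_sphere_subset_iff:
  fixes K :: "'a::real_normed_vector set"
  assumes K: "open_cone K" "0 \<notin> K" and L: "open_cone L"
  shows "sphere 0 1 \<inter> K \<subseteq> L \<longleftrightarrow> K \<subseteq> L"
proof
  assume *: "sphere 0 1 \<inter> K \<subseteq> L"
  show "K \<subseteq> L"
  proof
    fix x assume x: "x \<in> K"
    then have "x \<noteq> 0"
      using K(2) by auto
    then have "x /\<^sub>R norm x \<in> sphere 0 1 \<inter> K"
      using x open_cone_scale[OF K(1)] by simp
    then have "x /\<^sub>R norm x \<in> L"
      using * by blast
    then show "x \<in> L"
      using \<open>x \<noteq> 0\<close> open_cone_scale_iff[OF L, of "inverse (norm x)"] by simp
  qed
qed blast

section \<open>The signed group-set of the sphere\<close>

context
  fixes B :: "'a::real_inner set"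
  assumes B: "finite B" "span B = (UNIV :: 'a set)"
begin

lemma orthogonal_transformation_inverse_fin:
  fixes g :: "'a \<Rightarrow> 'a"
  assumes g: "orthogonal_transformation g"
  obtains h where "orthogonal_transformation h" "h \<circ> g = id" "g \<circ> h = id"
proof
  let ?h = "inv_into UNIV g"
  have lin: "linear g"
    using g by (rule orthogonal_transformation_linear)
  have right: "g (?h x) = x" and left: "?h (g x) = x" for x
    using orthogonal_transformation_inj[OF g] orthogonal_transformation_surj_fin[OF g B]
    by (simp_all add: surj_f_inv_f)
  then show "?h \<circ> g = id" "g \<circ> ?h = id"
    by (simp_all add: fun_eq_iff)
  have "linear ?h"
  proof (rule linearI)
    show "?h (x + y) = ?h x + ?h y" for x y
      using left[of "?h x + ?h y"] by (simp add: linear_add[OF lin] right)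
    show "?h (c *\<^sub>R x) = c *\<^sub>R ?h x" for c x
      using left[of "c *\<^sub>R ?h x"] by (simp add: linear_scale[OF lin] right)
  qed
  moreover have "?h v \<bullet> ?h w = v \<bullet> w" for v w
    using g right[of v] right[of w] unfolding orthogonal_transformation_def by metis
  ultimately show "orthogonal_transformation ?h"
    by (simp add: orthogonal_transformation_def)
qed

lemma group_orthogonal_group: "group (orthogonal_group :: ('a \<Rightarrow> 'a) monoid)"
proof (rule groupI)
  fix g :: "'a \<Rightarrow> 'a" assume "g \<in> carrier orthogonal_group"
  then obtain h :: "'a \<Rightarrow> 'a" where "orthogonal_transformation h" "h \<circ> g = id"
    using orthogonal_transformation_inverse_fin by (auto simp: orthogonal_group_def)
  then show "\<exists>h\<in>carrier orthogonal_group. h \<otimes>\<^bsub>orthogonal_group\<^esub> g = \<one>\<^bsub>orthogonal_group\<^esub>"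
    by (auto simp: orthogonal_group_def)
qed (auto simp: orthogonal_group_def orthogonal_transformation_compose comp_assoc id_def)

text \<open>\<open>sphere_action\<close> takes a default value off the sphere, so the outer map can
  be evaluated only because a sign \<open>t\<close> keeps the inner value at norm 1.\<close>

lemma sphere_action_compose:
  fixes g h :: "'a \<Rightarrow> 'a"
  assumes "orthogonal_transformation g" "orthogonal_transformation h" "t \<in> {-1, 1}"
  shows "compose (sphere 0 1) (sphere_action (g, s)) (sphere_action (h, t))
    = sphere_action (g \<circ> h, s * t)"
proof
  fix x :: 'a
  have "\<bar>real_of_int t\<bar> = 1"
    using assms(3) by auto
  then have "norm x = 1 \<Longrightarrow> norm (of_int t *\<^sub>R h x) = 1"
    using orthogonal_transformation_norm[OF assms(2), of x] by simp
  moreover have "g (of_int t *\<^sub>R h x) = of_int t *\<^sub>R g (h x)"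
    by (rule orthogonal_transformation_scaleR[OF assms(1)])
  ultimately show "compose (sphere 0 1) (sphere_action (g, s)) (sphere_action (h, t)) x
      = sphere_action (g \<circ> h, s * t) x"
    by (cases "norm x = 1") (simp_all add: compose_def sphere_action_def)
qed

text \<open>A sign is its own inverse, so the inverse map is the action of the inverse of
  \<open>g\<close> with the same \<open>s\<close>.\<close>

lemma sphere_action_in_Bij:
  fixes g :: "'a \<Rightarrow> 'a"
  assumes g: "orthogonal_transformation g" and s: "s \<in> {-1, 1}"
  shows "sphere_action (g, s) \<in> Bij (sphere 0 1)"
proof -
  let ?S = "sphere 0 1 :: 'a set"
  obtain g' where g': "orthogonal_transformation g'" "g' \<circ> g = id" "g \<circ> g' = id"
    using orthogonal_transformation_inverse_fin[OF g] .
  have closed: "sphere_action (h, s) x \<in> ?S" if "orthogonal_transformation h" "x \<in> ?S" for h x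
    using that s by (auto simp: sphere_action_def orthogonal_transformation_norm)
  have "s * s = 1"
    using s by auto
  then have inverse: "compose ?S (sphere_action (g, s)) (sphere_action (g', s)) = sphere_action (id, 1)"
    "compose ?S (sphere_action (g', s)) (sphere_action (g, s)) = sphere_action (id, 1)"
    using sphere_action_compose[OF g g'(1) s, of s] sphere_action_compose[OF g'(1) g s, of s] g'(2,3)
    by simp_all
  have id: "sphere_action (id, 1) = (\<lambda>x\<in>?S. x)"
    by (simp add: sphere_action_def fun_eq_iff)
  have "bij_betw (sphere_action (g, s)) ?S ?S"
  proof (rule bij_betwI[of _ _ _ "sphere_action (g', s)"])
    show "sphere_action (g', s) (sphere_action (g, s) x) = x"
      "sphere_action (g, s) (sphere_action (g', s) x) = x" if "x \<in> ?S" for x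
      using fun_cong[OF inverse(2), of x, unfolded id] fun_cong[OF inverse(1), of x, unfolded id] that
      by (simp_all add: compose_def)
  qed (use closed g g' in auto)
  then show ?thesis
    by (simp add: Bij_def sphere_action_def)
qed

lemma group_action_sphere:
  "group_action (orthogonal_group \<times>\<times> sign_img) (sphere 0 1 :: 'a set) sphere_action"
proof (intro group_action.intro group_hom.intro group_hom_axioms.intro homI)
  show "group ((orthogonal_group :: ('a \<Rightarrow> 'a) monoid) \<times>\<times> sign_img)"
    by (intro DirProd_group group_orthogonal_group sign_img_is_group)
  show "group (BijGroup (sphere 0 1 :: 'a set))"
    by (rule group_BijGroup)
  have Bij: "sphere_action p \<in> Bij (sphere 0 1)"
    if "p \<in> carrier ((orthogonal_group :: ('a \<Rightarrow> 'a) monoid) \<times>\<times> sign_img)" for p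
    using that sphere_action_in_Bij by (auto simp: orthogonal_group_def sign_img_def)
  then show "sphere_action p \<in> carrier (BijGroup (sphere 0 1))"
    if "p \<in> carrier ((orthogonal_group :: ('a \<Rightarrow> 'a) monoid) \<times>\<times> sign_img)" for p
    using that by (simp add: BijGroup_def)
  show "sphere_action (p \<otimes>\<^bsub>orthogonal_group \<times>\<times> sign_img\<^esub> q)
      = sphere_action p \<otimes>\<^bsub>BijGroup (sphere 0 1)\<^esub> sphere_action q"
    if pq: "p \<in> carrier ((orthogonal_group :: ('a \<Rightarrow> 'a) monoid) \<times>\<times> sign_img)"
      "q \<in> carrier ((orthogonal_group :: ('a \<Rightarrow> 'a) monoid) \<times>\<times> sign_img)" for p q
  proof -
    obtain g s h t where "p = (g, s)" "q = (h, t)"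
      by (metis surj_pair)
    then show ?thesis
      using pq Bij[OF pq(1)] Bij[OF pq(2)] sphere_action_compose[of g h t s]
      by (simp add: BijGroup_def orthogonal_group_def sign_img_def)
  qed
qed

lemma signed_group_set_sphere:
  fixes P :: "'a set"
  assumes P: "total_cone P"
  shows "signed_group_set orthogonal_group (sphere 0 1) sphere_action
    (sphere 0 1 \<inter> P) (uminus ` (sphere 0 1 \<inter> P))"
proof (intro signed_group_set.intro signed_group_set_axioms.intro)
  let ?S = "sphere 0 1 :: 'a set"
  show "?S = ?S \<inter> P \<union> uminus ` (?S \<inter> P)"
  proof (intro subset_antisym subsetI)
    fix x assume x: "x \<in> ?S"
    then have "x \<noteq> 0" by auto
    then show "x \<in> ?S \<inter> P \<union> uminus ` (?S \<inter> P)"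
      using x total_cone_minus_iff[OF P, of x] image_eqI[of x uminus "- x"] by auto
  qed auto
  show "(?S \<inter> P) \<inter> uminus ` (?S \<inter> P) = {}"
    using total_cone_minus[OF P] by auto
  have act: "sphere_action (\<one>\<^bsub>orthogonal_group\<^esub>, - 1) ` A = uminus ` A" if "A \<subseteq> ?S" for A
    using that by (intro image_cong) (auto simp: sphere_action_def orthogonal_group_def)
  show "sphere_action (\<one>\<^bsub>orthogonal_group\<^esub>, - 1) ` (?S \<inter> P) = uminus ` (?S \<inter> P)"
    by (rule act) auto
  show "sphere_action (\<one>\<^bsub>orthogonal_group\<^esub>, - 1) ` uminus ` (?S \<inter> P) = ?S \<inter> P"
    by (subst act) (auto simp: image_image)
qed (intro group_orthogonal_group group_action_sphere)+

end

lemma sphere_inversion_set: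
  assumes g: "orthogonal_transformation g" and P: "total_cone P"
  shows "(sphere 0 1 \<inter> P) \<inter> sphere_action (g, 1) ` uminus ` (sphere 0 1 \<inter> P)
    = sphere 0 1 \<inter> inversions P (g ` P)"
proof -
  have "sphere_action (g, 1) ` uminus ` (sphere 0 1 \<inter> P) = (\<lambda>x. - g x) ` (sphere 0 1 \<inter> P)"
    unfolding image_image
    by (intro image_cong) (auto simp: sphere_action_def linear_neg orthogonal_transformation_linear[OF g])
  moreover have "x \<in> (\<lambda>x. - g x) ` (sphere 0 1 \<inter> P) \<longleftrightarrow> x \<in> sphere 0 1 \<and> - x \<in> g ` P" for x
  proof
    assume "x \<in> sphere 0 1 \<and> - x \<in> g ` P"
    then obtain y where y: "- x = g y" "y \<in> P" "norm x = 1"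
      by auto
    then have "x = - g y" "norm y = 1"
      using orthogonal_transformation_norm[OF g, of y] by (auto simp flip: y(1))
    with y(2) show "x \<in> (\<lambda>x. - g x) ` (sphere 0 1 \<inter> P)"
      by auto
  qed (auto simp: orthogonal_transformation_norm[OF g])
  ultimately show ?thesis
    by (auto simp: inversions_def)
qed

lemma complete_rootoidal_sphere:
  fixes P B :: "'a::real_inner set"
  assumes P: "total_cone P" and B: "finite B" "span B = (UNIV :: 'a set)"
  shows "complete_rootoidal_signed_group_set orthogonal_group (sphere 0 1) sphere_action
    (sphere 0 1 \<inter> P) (uminus ` (sphere 0 1 \<inter> P))"
proof -
  let ?S = "sphere 0 1 :: 'a set"
  interpret signed_group_set orthogonal_group ?S sphere_action "?S \<inter> P" "uminus ` (?S \<inter> P)"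
    by (rule signed_group_set_sphere[OF B P])
  have carrier_G: "g \<in> carrier orthogonal_group \<longleftrightarrow> orthogonal_transformation g" for g :: "'a \<Rightarrow> 'a"
    by (simp add: orthogonal_group_def)
  have inv_set: "inversion_set g = ?S \<inter> inversions P (g ` P)" if "orthogonal_transformation g" for g
    using sphere_inversion_set[OF that P] by (simp add: inversion_set_def)
  have image: "total_cone (g ` P)" if "orthogonal_transformation g" for g :: "'a \<Rightarrow> 'a"
    using that by (intro total_cone_image P orthogonal_transformation_surj_fin[OF _ B])
  \<comment> \<open>This replaces group elements by biconvex cones; the rest of the proof mentions
    the group again only for axiom (4).\<close>
  have carrier: "carrier weak_order = {?S \<inter> K | K. biconvex P K}"
  proof (intro subset_antisym subsetI)
    fix A assume "A \<in> carrier weak_order"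
    then obtain g where "orthogonal_transformation g" "A = inversion_set g"
      by (auto simp: weak_order_def carrier_G)
    then show "A \<in> {?S \<inter> K | K. biconvex P K}"
      using inv_set biconvex_inversions[OF P image] by blast
  next
    fix A assume "A \<in> {?S \<inter> K | K. biconvex P K}"
    then obtain K where K: "A = ?S \<inter> K" "biconvex P K"
      by blast
    then obtain Q where Q: "total_cone Q" "K = inversions P Q"
      using total_cone_of_biconvex[OF P] by metis
    obtain g where "orthogonal_transformation g" "Q = g ` P"
      using total_cone_conjugate[OF P B Q(1)] by blast
    then show "A \<in> carrier weak_order"
      using K(1) Q(2) inv_set by (auto simp: weak_order_def carrier_G)
  qed
  have le: "A \<sqsubseteq>\<^bsub>weak_order\<^esub> A' \<longleftrightarrow> A \<subseteq> A'" for A A'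
    by (simp add: weak_order_def)
  have zero: "0 \<notin> K" if "biconvex P K" for K
    using that total_cone_zero[OF P] by (auto simp: biconvex_def)
  have empty: "biconvex P {}"
    using total_cone_open_cone[OF P] by (simp add: biconvex_def open_cone_def)
  have full: "biconvex P P"
    using biconvex_compl[OF empty] by simp
  have compl: "?S \<inter> P - A \<in> carrier weak_order" if "A \<in> carrier weak_order" for A
  proof -
    obtain K where K: "A = ?S \<inter> K" "biconvex P K"
      using \<open>A \<in> carrier weak_order\<close> carrier by blast
    then have "?S \<inter> P - A = ?S \<inter> (P - K)"
      by auto
    then show ?thesis
      using biconvex_compl[OF K(2)] carrier by blast
  qed
  obtain e n where e: "perp n e = {0}" "P = lex_pos n e"
    using total_cone_lex_basis[OF P B] by blast
  show ?thesis
  proof unfold_locales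
    fix g :: "'a \<Rightarrow> 'a" assume "g \<in> carrier orthogonal_group" and empty: "inversion_set g = {}"
    then have g: "orthogonal_transformation g"
      by (simp add: carrier_G)
    have "biconvex P (inversions P (g ` P))"
      using biconvex_inversions[OF P image[OF g]] .
    \<comment> \<open>The empty set is itself an open cone, so emptiness passes from the trace on
      the sphere to the cone.\<close>
    then have "inversions P (g ` P) \<subseteq> {}"
      using open_cone_sphere_subset_iff[of "inversions P (g ` P)" "{}"] empty inv_set[OF g] zero
      by (auto simp: biconvex_def open_cone_def)
    then have "g ` P = P"
      using inversions_eq_empty[OF P image[OF g]] by blast
    then show "g = \<one>\<^bsub>orthogonal_group\<^esub>"
      using total_cone_stabilizer_trivial[OF P B g] by (simp add: orthogonal_group_def)
  next
    fix \<A> assume \<A>: "\<A> \<subseteq> carrier weak_order" "\<A> \<noteq> {}"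
    \<comment> \<open>An intersection of biconvex cones need not have a convex complement, so the
      meet is built from below, as the hull of all lower bounds. It stays inside each member of the
      family because that member is the trace of a cone containing every element of
      \<open>\<K>\<close>.\<close>
    define \<K> where "\<K> = {K. biconvex P K \<and> (\<forall>A\<in>\<A>. ?S \<inter> K \<subseteq> A)}"
    define C where "C = additive_hull (\<Union>\<K>)"
    have C: "biconvex P C"
      unfolding C_def by (rule biconvex_additive_hull[OF P _ e(2,1)]) (simp add: \<K>_def)
    have "?S \<inter> C \<subseteq> A" if A: "A \<in> \<A>" for A
    proof -
      obtain L where L: "A = ?S \<inter> L" "biconvex P L"
        using subsetD[OF \<A>(1) A] unfolding carrier by blast
      have "K \<subseteq> L" if "K \<in> \<K>" for K
      proof -
        have K: "biconvex P K" "?S \<inter> K \<subseteq> L"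
          using that A L(1) unfolding \<K>_def by blast+
        then show ?thesis
          using open_cone_sphere_subset_iff[of K L] zero L(2) unfolding biconvex_def by blast
      qed
      then have "C \<subseteq> L"
        unfolding C_def using L(2) unfolding biconvex_def by (intro additive_hull_minimal) blast+
      then show ?thesis
        using L(1) by blast
    qed
    moreover have "A' \<subseteq> ?S \<inter> C" if A': "A' \<in> carrier weak_order" "\<forall>A\<in>\<A>. A' \<subseteq> A" for A'
    proof -
      obtain K where K: "A' = ?S \<inter> K" "biconvex P K"
        using A'(1) unfolding carrier by blast
      have "K \<in> \<K>"
        using A'(2) K unfolding \<K>_def by blast
      then have "K \<subseteq> C"
        unfolding C_def by (blast intro: additive_hull.base)
      then show ?thesis
        using K(1) by blast
    qed
    moreover have "?S \<inter> C \<in> carrier weak_order"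
      unfolding carrier using C by blast
    ultimately have "is_glb weak_order (?S \<inter> C) \<A>"
      using \<A>(1) unfolding greatest_def Lower_def le by blast
    then show "\<exists>M. is_glb weak_order M \<A>" ..
  next
    fix \<A> A B J
    assume \<A>: "\<A> \<subseteq> carrier weak_order" and B: "B \<in> carrier weak_order"
      and disjoint: "\<And>A. A \<in> \<A> \<Longrightarrow> A \<inter> B = {}" and J: "is_lub weak_order J \<A>"
    have "A \<subseteq> ?S \<inter> P - B" if "A \<in> \<A>" for A
    proof -
      have "A \<subseteq> ?S \<inter> P"
        using subsetD[OF \<A> that] unfolding carrier biconvex_def by blast
      with disjoint[OF that] show ?thesis
        by blast
    qed
    then have "J \<subseteq> ?S \<inter> P - B"
      using J compl[OF B] by (auto simp: least_def Upper_def le)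
    then show "J \<inter> B = {}"
      by blast
  next
    \<comment> \<open>This maximum is the inversion set of the map
      \<open>v \<mapsto> - v\<close>.\<close>
    have "greatest weak_order (?S \<inter> P) (carrier weak_order)"
      unfolding greatest_def le carrier
    proof (intro conjI ballI)
      show "?S \<inter> P \<in> {?S \<inter> K | K. biconvex P K}"
        using full by blast
    qed (auto simp: biconvex_def)
    then show "\<exists>M. greatest weak_order M (carrier weak_order)" ..
  qed
qed

theorem theorem1p1:
  fixes le lt :: "'a::real_inner \<Rightarrow> 'a \<Rightarrow> bool"
  assumes "\<exists>B::'a set. finite B \<and> span B = UNIV"
    and "vector_space_total_ordering le lt"
  shows "complete_rootoidal_signed_group_set
    (orthogonal_group :: ('a \<Rightarrow> 'a) monoid) (sphere 0 1) sphere_action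
    {v \<in> sphere 0 1. lt 0 v} (uminus ` {v \<in> sphere 0 1. lt 0 v})"
proof -
  obtain B :: "'a set" where B: "finite B" "span B = UNIV"
    using assms(1) by blast
  have "{v \<in> sphere 0 1. lt 0 v} = sphere 0 1 \<inter> {v. lt 0 v}"
    by blast
  then show ?thesis
    using complete_rootoidal_sphere[OF
        vector_space_total_ordering.total_cone_positive[OF assms(2)] B] by simp
qed

end
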